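(* Let $(X,Y)$ be a bivariate random vector with a positively dependent copula $C$ (i.e. $uv\le C(u,v)\le\min(u,v)$ for all $(u,v)\in[0,1]^2$) and margins $F_X,F_Y$, and let $f_Y$ be the probability density function of $Y$. Let $\alpha,\beta\in(0,1)$ and let $\omega=\omega(\alpha,\beta,C)$ be the largest solution of $1-\alpha-\omega+C(\alpha,\omega)=(1-\alpha)(1-\beta)$. Then the sensitivity functions $S_1(l)$ and $S_2(l)$, $l\in\mathbb R$, of $\mathrm{CoVaR}_{\alpha,\beta}(Y\mid X)$ and $\mathrm{CoES}_{\alpha,\beta}(Y\mid X)$ (for the historical estimators) are, respectively, $$S_1(l)=\begin{cases}\dfrac{\omega}{f_Y(\mathrm{VaR}_\omega(Y))}&\text{if }l>\mathrm{VaR}_\omega(Y),\\[2mm]0&\text{if }l=\mathrm{VaR}_\omega(Y),\\[1mm]\dfrac{\omega-1}{f_Y(\mathrm{VaR}_\omega(Y))}&\text{if }l<\mathrm{VaR}_\omega(Y),\end{cases}$$ and $$S_2(l)=\begin{cases}\dfrac{l}{1-\omega}-\dfrac{\omega}{1-\omega}\mathrm{VaR}_\omega(Y)+\mathrm{ES}_\omega(Y)&\text{if }l\ge\mathrm{VaR}_\omega(Y),\\[2mm]\mathrm{VaR}_\omega(Y)+\mathrm{ES}_\omega(Y)&\text{if }l\le\mathrm{VaR}_\omega(Y).\end{cases}$$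
   Context: For a distribution function $F$ and $q\in(0,1)$: $\mathrm{VaR}_q(F)=F^{-1}(q)$ and $\mathrm{ES}_q(F)=\frac1{1-q}\int_q^1F^{-1}(p)\,dp$; $\mathrm{VaR}_q(Y)=\mathrm{VaR}_q(F_Y)$ and similarly for $\mathrm{ES}$. The copula $C$ satisfies $P(X\le x,Y\le y)=C(F_X(x),F_Y(y))$. The measures are taken in the copula-representation form $\mathrm{CoVaR}_{\alpha,\beta}(Y\mid X)=\mathrm{VaR}_\omega(Y)$ and $\mathrm{CoES}_{\alpha,\beta}(Y\mid X)=\mathrm{ES}_\omega(Y)$, and their historical estimators are the empirical versions of $\mathrm{VaR}_\omega$ and $\mathrm{ES}_\omega$ at the level $\omega$, so that the associated asymptotic risk functionals are $\rho_{eff}(F)=\mathrm{VaR}_\omega(F)$ and $\rho_{eff}(F)=\mathrm{ES}_\omega(F)$ with $\omega$ held fixed. The sensitivity function of $\rho_{eff}$ at $F$ is $$S(l;F)=\lim_{\epsilon\to0^+}\frac{\rho_{eff}((1-\epsilon)F+\epsilon\Delta_l)-\rho_{eff}(F)}{\epsilon},$$ where $\Delta_l$ is the point mass (Dirac) distribution at $l\in\mathbb R$; here $F=F_Y$ and $S_i(l)=S(l;F_Y)$.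
   Formalization: In both branches of S_2 the term +ES_ω(Y) is corrected to −ES_ω(Y) (the printed sign fails, e.g. for independent uniforms); also assumed: F_Y is differentiable at VaR_ω(Y) with derivative f_Y(VaR_ω(Y)) > 0, and, for S_2 only, ES_ω(Y) is finite. *)

theory Defs
  imports "HOL-Probability.Probability"
begin

definition is_copula :: "(real \<Rightarrow> real \<Rightarrow> real) \<Rightarrow> bool" where
  "is_copula C \<longleftrightarrow>
     (\<forall>u\<in>{0..1}. C u 0 = 0 \<and> C 0 u = 0 \<and> C u 1 = u \<and> C 1 u = u) \<and>
     (\<forall>u\<^sub>1\<in>{0..1}. \<forall>u\<^sub>2\<in>{0..1}. \<forall>v\<^sub>1\<in>{0..1}. \<forall>v\<^sub>2\<in>{0..1}. u\<^sub>1 \<le> u\<^sub>2 \<longrightarrow> v\<^sub>1 \<le> v\<^sub>2 \<longrightarrow>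
        0 \<le> C u\<^sub>2 v\<^sub>2 - C u\<^sub>2 v\<^sub>1 - C u\<^sub>1 v\<^sub>2 + C u\<^sub>1 v\<^sub>1)"

definition positively_dependent :: "(real \<Rightarrow> real \<Rightarrow> real) \<Rightarrow> bool" where
  "positively_dependent C \<longleftrightarrow>
     (\<forall>u\<in>{0..1}. \<forall>v\<in>{0..1}. u * v \<le> C u v \<and> C u v \<le> min u v)"

abbreviation distribution_fun :: "'a measure \<Rightarrow> ('a \<Rightarrow> real) \<Rightarrow> real \<Rightarrow> real" where
  "distribution_fun M Y \<equiv> cdf (distr M borel Y)"

definition has_copula ::
  "'a measure \<Rightarrow> ('a \<Rightarrow> real) \<Rightarrow> ('a \<Rightarrow> real) \<Rightarrow> (real \<Rightarrow> real \<Rightarrow> real) \<Rightarrow> bool" where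
  "has_copula M X Y C \<longleftrightarrow> is_copula C \<and>
     (\<forall>x y. measure M {s \<in> space M. X s \<le> x \<and> Y s \<le> y} =
        C (distribution_fun M X x) (distribution_fun M Y y))"

text \<open>Risk measures are functionals of distribution functions, and a distribution function
  is represented as a function on the reals. The quantile (left-continuous generalized
  inverse) is meaningful at levels strictly between 0 and 1 only.\<close>

definition quantile :: "(real \<Rightarrow> real) \<Rightarrow> real \<Rightarrow> real" where
  "quantile F p = Inf {x. p \<le> F x}"

definition VaR :: "real \<Rightarrow> (real \<Rightarrow> real) \<Rightarrow> real" where
  "VaR q F = quantile F q"

text \<open>If the quantile function is not integrable over the tail, the integral below is 0 by
  convention, so finiteness has to be required separately, by \<open>ES_finite\<close>.\<close>

definition ES :: "real \<Rightarrow> (real \<Rightarrow> real) \<Rightarrow> real" where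
  "ES q F = 1 / (1 - q) * (LINT p:{q<..<1}|lborel. quantile F p)"

definition ES_finite :: "real \<Rightarrow> (real \<Rightarrow> real) \<Rightarrow> bool" where
  "ES_finite q F \<longleftrightarrow> set_integrable lborel {q<..<1} (quantile F)"

definition omega_level :: "real \<Rightarrow> real \<Rightarrow> (real \<Rightarrow> real \<Rightarrow> real) \<Rightarrow> real" where
  "omega_level \<alpha> \<beta> C =
     (GREATEST w. w \<in> {0..1} \<and> 1 - \<alpha> - w + C \<alpha> w = (1 - \<alpha>) * (1 - \<beta>))"

text \<open>CoVaR and CoES in copula form. As functionals of the distribution function of \<open>Y\<close>, with
  the copula and hence the level held fixed, they are the asymptotic risk functionals of the
  historical estimators.\<close>

definition CoVaR :: "real \<Rightarrow> real \<Rightarrow> (real \<Rightarrow> real \<Rightarrow> real) \<Rightarrow> (real \<Rightarrow> real) \<Rightarrow> real" where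
  "CoVaR \<alpha> \<beta> C F = VaR (omega_level \<alpha> \<beta> C) F"

definition CoES :: "real \<Rightarrow> real \<Rightarrow> (real \<Rightarrow> real \<Rightarrow> real) \<Rightarrow> (real \<Rightarrow> real) \<Rightarrow> real" where
  "CoES \<alpha> \<beta> C F = ES (omega_level \<alpha> \<beta> C) F"

definition contaminate :: "real \<Rightarrow> real \<Rightarrow> (real \<Rightarrow> real) \<Rightarrow> real \<Rightarrow> real" where
  "contaminate \<epsilon> l F = (\<lambda>x. (1 - \<epsilon>) * F x + \<epsilon> * cdf (return borel l) x)"

text \<open>\<open>has_sensitivity \<rho> F l s\<close>: the limit defining the sensitivity function of \<open>\<rho>\<close> at \<open>F\<close>
  and \<open>l\<close> exists and equals \<open>s\<close>.

  For \<open>\<rho> = ES q\<close> this sensitivity contains the term \<open>- ES q F\<close>. A formula with \<open>+ ES q F\<close>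
  cannot hold for the present sign convention: shifting the distribution and \<open>l\<close> by the same
  constant shifts \<open>VaR\<close> and \<open>ES\<close> by it and must leave the sensitivity unchanged.\<close>

definition has_sensitivity ::
  "((real \<Rightarrow> real) \<Rightarrow> real) \<Rightarrow> (real \<Rightarrow> real) \<Rightarrow> real \<Rightarrow> real \<Rightarrow> bool" where
  "has_sensitivity \<rho> F l s \<longleftrightarrow>
     ((\<lambda>\<epsilon>. (\<rho> (contaminate \<epsilon> l F) - \<rho> F) / \<epsilon>) \<longlongrightarrow> s) (at_right 0)"

end

theory Submission
  imports Defs
begin

text \<open>On [0,1] the map sending w to 1 - \<alpha> - w + C(\<alpha>, w) is continuous and runs
  from 1 - \<alpha> to 0, and the target (1 - \<alpha>)(1 - \<beta>) lies strictly in between. So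
  \<omega> exists and is in (0,1) (\<open>omega_level_bounds\<close>), and the claim concerns
  \<open>VaR\<close> and \<open>ES\<close> at a fixed interior level q = \<omega>.

  \<open>VaR\<close>: for small \<epsilon> the q-quantile of the contaminated law is a quantile of
  the original law at a shifted level, namely q/(1 - \<epsilon>) if l > v, (q - \<epsilon>)/(1 -
  \<epsilon>) if l < v, and q if l = v. These levels move at speeds q, q - 1 and 0 at \<epsilon> =
  0. The quantile function has derivative 1 / \<open>f\<^sub>Y v\<close> at q by the inverse
  function theorem (\<open>DERIV_quantile\<close>), and the chain rule finishes
  (\<open>has_sensitivity_quantile_shift\<close>, \<open>has_sensitivity_VaR\<close>).

  \<open>ES\<close>: (1 - q) ES is the minimum over t of A(t) = (1 - q) t + E max(0, Y - t),
  attained at t = v (\<open>ES_stop_loss\<close>). Contamination turns A into (1 - \<epsilon>) A +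
  \<epsilon> B, where B is the objective of the point mass at l. By an envelope argument the minimum
  has right derivative B(v) - A(v) at 0; division by 1 - q gives v + max(0, l - v)/(1 - q) - ES
  (\<open>has_sensitivity_ES\<close>). The argument needs the contaminated \<open>VaR\<close> to
  tend to v, which the first half supplies.\<close>

section \<open>Copula sections and the position of the level \<omega>\<close>

lemma greatest_real_attained:
  fixes P :: "real \<Rightarrow> bool"
  assumes "compact {x. P x}" and "\<exists>x. P x"
  shows "P (GREATEST x. P x)"
proof -
  obtain x where "P x" and "\<And>y. P y \<Longrightarrow> y \<le> x"
    using compact_attains_sup[OF assms(1)] assms(2) by auto
  then show ?thesis
    by (rule GreatestI2_order)
qed

text \<open>The rectangle inequality on [0,a] x [v,v'] gives monotonicity; on [a,1] x [v,v'] it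
  bounds the increment by that of C(1, .), which is the identity.\<close>

lemma copula_lipschitz:
  assumes C: "is_copula C" and a: "a \<in> {0..1}" and v: "v \<in> {0..1}" and w: "w \<in> {0..1}"
  shows "\<bar>C a w - C a v\<bar> \<le> \<bar>w - v\<bar>"
proof -
  have "0 \<le> C a v' - C a v \<and> C a v' - C a v \<le> v' - v"
    if "v \<le> v'" "v \<in> {0..1}" "v' \<in> {0..1}" for v v'
  proof
    have rect: "0 \<le> C u2 v' - C u2 v - C u1 v' + C u1 v"
      if "u1 \<in> {0..1}" "u2 \<in> {0..1}" "u1 \<le> u2" for u1 u2
      using C that \<open>v \<le> v'\<close> \<open>v \<in> {0..1}\<close> \<open>v' \<in> {0..1}\<close> unfolding is_copula_def by blast
    have zero: "C 0 v = 0" "C 0 v' = 0" and one: "C 1 v = v" "C 1 v' = v'"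
      using C that unfolding is_copula_def by auto
    show "0 \<le> C a v' - C a v"
      using rect[of 0 a] a zero by simp
    show "C a v' - C a v \<le> v' - v"
      using rect[of a 1] a one by simp
  qed
  from this[of v w] this[of w v] v w show ?thesis
    by (cases "v \<le> w") auto
qed

lemma continuous_on_copula:
  assumes "is_copula C" and "a \<in> {0..1}"
  shows "continuous_on {0..1} (C a)"
  using copula_lipschitz[OF assms]
  by (intro Lipschitz.lipschitz_on_continuous_on[where L = 1] Lipschitz.lipschitz_onI)
     (auto simp: dist_real_def)

lemma omega_level_bounds:
  assumes C: "is_copula C" and \<alpha>: "0 < \<alpha>" "\<alpha> < 1" and \<beta>: "0 < \<beta>" "\<beta> < 1"
  shows "0 < omega_level \<alpha> \<beta> C" and "omega_level \<alpha> \<beta> C < 1"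
proof -
  define g where "g w = 1 - \<alpha> - w + C \<alpha> w" for w
  define c where "c = (1 - \<alpha>) * (1 - \<beta>)"
  have g0: "g 0 = 1 - \<alpha>" and g1: "g 1 = 0"
    using C \<alpha> unfolding is_copula_def g_def by auto
  have c: "0 < c" "c < 1 - \<alpha>"
    using \<alpha> \<beta> by (auto simp: c_def mult_less_cancel_left2)
  have cont: "continuous_on {0..1} g"
    unfolding g_def using C \<alpha> by (intro continuous_intros continuous_on_copula) auto
  have "\<exists>w\<ge>0. w \<le> 1 \<and> g w = c"
    using IVT2'[of g 1 c 0] g0 g1 c cont by auto
  \<comment> \<open>\<open>GREATEST\<close> is informative only if a maximum is attained; the
    solution set is closed in [0,1], hence compact.\<close>
  moreover have "compact {w. w \<in> {0..1} \<and> g w = c}"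
  proof -
    have "closed ({0..1} \<inter> g -` {c})"
      by (intro continuous_closed_preimage cont) auto
    then have "compact ({0..1} \<inter> ({0..1} \<inter> g -` {c}))"
      by (intro compact_Int_closed) auto
    also have "{0..1} \<inter> ({0..1} \<inter> g -` {c}) = {w. w \<in> {0..1} \<and> g w = c}"
      by auto
    finally show ?thesis .
  qed
  ultimately have "(GREATEST w. w \<in> {0..1} \<and> g w = c) \<in> {0..1} \<and>
      g (GREATEST w. w \<in> {0..1} \<and> g w = c) = c"
    by (intro greatest_real_attained[of "\<lambda>w. w \<in> {0..1} \<and> g w = c"]) auto
  moreover have "omega_level \<alpha> \<beta> C = (GREATEST w. w \<in> {0..1} \<and> g w = c)"
    unfolding omega_level_def g_def c_def ..
  ultimately have "omega_level \<alpha> \<beta> C \<in> {0..1} \<and> g (omega_level \<alpha> \<beta> C) = c"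
    by simp
  moreover have "g 0 \<noteq> c" and "g 1 \<noteq> c"
    using g0 g1 c by auto
  ultimately show "0 < omega_level \<alpha> \<beta> C" and "omega_level \<alpha> \<beta> C < 1"
    by (auto simp: order_less_le)
qed

section \<open>Quantile functions: Galois connection, representation of the law, derivative\<close>

text \<open>This Galois connection translates inequalities between quantiles into inequalities for
  the distribution function. Inside \<open>cdf_distribution\<close>, \<open>quantile\<close> unfolds
  to the generalized inverse treated there.\<close>

lemma quantile_le_iff:
  assumes "real_distribution N" and "0 < p" "p < 1"
  shows "quantile (cdf N) p \<le> x \<longleftrightarrow> p \<le> cdf N x"
proof -
  interpret cdf_distribution N
    using assms(1) unfolding cdf_distribution_def .
  show ?thesis
    unfolding quantile_def by (rule pseudoinverse[OF assms(2,3), symmetric])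
qed

text \<open>Inverse transform sampling; it later turns expectations under \<open>N\<close> into
  integrals of the quantile function over (0,1).\<close>

lemma distr_quantile:
  assumes "real_distribution N"
  shows "distr (restrict_space lborel {0<..<1}) borel (quantile (cdf N)) = N"
proof -
  interpret cdf_distribution N
    using assms unfolding cdf_distribution_def .
  show ?thesis
    unfolding quantile_def[abs_def] by (rule distr_I_eq_M)
qed

lemma measurable_quantile:
  assumes "real_distribution N"
  shows "quantile (cdf N) \<in> borel_measurable (restrict_space borel {0<..<1})"
proof -
  interpret cdf_distribution N
    using assms unfolding cdf_distribution_def .
  show ?thesis
    unfolding quantile_def[abs_def] by (rule measurable_CI)
qed

lemma quantile_mono:
  assumes "real_distribution N" and "0 < p" "p \<le> q" "q < 1"
  shows "quantile (cdf N) p \<le> quantile (cdf N) q"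
  using assms quantile_le_iff[of N p "quantile (cdf N) q"] quantile_le_iff[of N q "quantile (cdf N) q"]
  by auto

text \<open>Left of the quantile the distribution function stays below p, and left continuity passes
  this bound to the quantile itself. The other inequality is the Galois connection.\<close>

lemma cdf_quantile:
  assumes N: "real_distribution N" and p: "0 < p" "p < 1"
    and cont: "isCont (cdf N) (quantile (cdf N) p)"
  shows "cdf N (quantile (cdf N) p) = p"
proof (rule antisym)
  let ?q = "quantile (cdf N) p"
  have "(cdf N \<longlongrightarrow> cdf N ?q) (at_left ?q)"
    using cont unfolding isCont_def by (rule tendsto_mono[rotated]) (simp add: at_le)
  moreover have "eventually (\<lambda>x. cdf N x \<le> p) (at_left ?q)"
    unfolding eventually_at_left_field using quantile_le_iff[OF N p]
    by (metis linorder_not_le lt_ex order_less_imp_le)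
  ultimately show "cdf N ?q \<le> p"
    by (intro tendsto_upperbound) auto
  show "p \<le> cdf N ?q"
    using quantile_le_iff[OF N p] by blast
qed

lemma cdf_less_right:
  assumes "real_distribution N" and "(cdf N has_real_derivative D) (at v)" "0 < D" "v < x"
  shows "cdf N v < cdf N x"
proof -
  interpret real_distribution N by fact
  obtain d where "0 < d" and d: "\<And>h. 0 < h \<Longrightarrow> h < d \<Longrightarrow> cdf N v < cdf N (v + h)"
    using DERIV_pos_inc_right[OF assms(2,3)] by auto
  then have "cdf N v < cdf N (v + min (d / 2) (x - v))"
    using \<open>v < x\<close> by (intro d) auto
  also have "\<dots> \<le> cdf N x"
    by (intro cdf_nondecreasing) auto
  finally show ?thesis .
qed

text \<open>Continuity of the distribution function makes the quantile a right inverse on all of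
  (0,1). Flat pieces may make the quantile jump elsewhere, but D > 0 excludes a jump at p, so the
  inverse function theorem applies there.\<close>

lemma DERIV_quantile:
  assumes N: "real_distribution N" and cont: "\<And>x. isCont (cdf N) x"
    and p: "0 < p" "p < 1"
    and der: "(cdf N has_real_derivative D) (at (quantile (cdf N) p))" and D: "0 < D"
  shows "(quantile (cdf N) has_real_derivative inverse D) (at p)"
proof (rule DERIV_inverse_function[where f = "cdf N" and a = 0 and b = 1])
  let ?Q = "quantile (cdf N)"
  show "cdf N (?Q y) = y" if "0 < y" "y < 1" for y
    using cdf_quantile[OF N that cont] .
  have ev: "\<forall>\<^sub>F y in at p. 0 < y \<and> y < 1"
    using p by (intro eventually_conj) (auto intro: order_tendstoD)
  show "isCont ?Q p"
    unfolding isCont_def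
  proof (rule order_tendstoI)
    fix a assume "a < ?Q p"
    then have "cdf N a < p"
      using quantile_le_iff[OF N p, of a] by auto
    then have "\<forall>\<^sub>F y in at p. cdf N a < y"
      by (auto intro: order_tendstoD)
    with ev show "\<forall>\<^sub>F y in at p. a < ?Q y"
      by eventually_elim (use quantile_le_iff[OF N] in \<open>metis not_le\<close>)
  next
    fix a assume "?Q p < a"
    \<comment> \<open>The Galois connection only yields a weak bound by b; the gap between b and a
      makes it strict.\<close>
    then obtain b where b: "?Q p < b" "b < a"
      using dense by blast
    have "p < cdf N b"
      using cdf_less_right[OF N der D b(1)] cdf_quantile[OF N p cont] by simp
    then have "\<forall>\<^sub>F y in at p. y < cdf N b"
      by (auto intro: order_tendstoD)
    with ev show "\<forall>\<^sub>F y in at p. ?Q y < a"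
      by eventually_elim (use quantile_le_iff[OF N] b(2) in \<open>meson le_less_trans less_imp_le\<close>)
  qed
qed (use p der D in auto)

section \<open>Contamination as a shift of level, and the sensitivity of VaR\<close>

lemma contaminate_eq:
  "contaminate \<epsilon> l F x = (1 - \<epsilon>) * F x + (if l \<le> x then \<epsilon> else 0)"
  by (simp add: contaminate_def cdf_def measure_return)

text \<open>A quantile depends on F only through one superlevel set. If contamination turns the set
  at level q into that of F at level p(\<epsilon>), the contaminated quantile is
  \<open>quantile F (p \<epsilon>)\<close> and the chain rule applies.\<close>

lemma has_sensitivity_quantile_shift:
  assumes Q: "(quantile F has_real_derivative D) (at q)"
    and p: "(p has_real_derivative d) (at 0)" "p 0 = q"
    and eq: "\<forall>\<^sub>F \<epsilon> in at_right 0. \<forall>x. q \<le> contaminate \<epsilon> l F x \<longleftrightarrow> p \<epsilon> \<le> F x"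
  shows "has_sensitivity (VaR q) F l (D * d)"
proof -
  have "((\<lambda>\<epsilon>. quantile F (p \<epsilon>)) has_real_derivative D * d) (at 0)"
    using DERIV_chain2[OF _ p(1), of "quantile F" D] Q p(2) by simp
  then have "((\<lambda>\<epsilon>. (quantile F (p \<epsilon>) - quantile F q) / \<epsilon>) \<longlongrightarrow> D * d) (at_right 0)"
    unfolding has_field_derivative_iff using p(2) by (auto intro: tendsto_mono[rotated] simp: at_le)
  moreover have "\<forall>\<^sub>F \<epsilon> in at_right 0. (quantile F (p \<epsilon>) - quantile F q) / \<epsilon> =
      (VaR q (contaminate \<epsilon> l F) - VaR q F) / \<epsilon>"
    using eq by eventually_elim (simp add: VaR_def quantile_def)
  ultimately show ?thesis
    unfolding has_sensitivity_def by (rule Lim_transform_eventually)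
qed

lemma has_sensitivity_VaR:
  fixes N q D l
  defines "v \<equiv> VaR q (cdf N)"
  assumes N: "real_distribution N" and cont: "\<And>x. isCont (cdf N) x"
    and q: "0 < q" "q < 1"
    and der: "(cdf N has_real_derivative D) (at v)" and D: "0 < D"
  shows "v < l \<Longrightarrow> has_sensitivity (VaR q) (cdf N) l (q / D)"
    and "l = v \<Longrightarrow> has_sensitivity (VaR q) (cdf N) l 0"
    and "l < v \<Longrightarrow> has_sensitivity (VaR q) (cdf N) l ((q - 1) / D)"
proof -
  interpret real_distribution N by fact
  have Q: "(quantile (cdf N) has_real_derivative inverse D) (at q)"
    using DERIV_quantile[OF N cont q _ D] der by (simp add: v_def VaR_def)
  have le_iff: "v \<le> x \<longleftrightarrow> q \<le> cdf N x" for x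
    unfolding v_def VaR_def by (rule quantile_le_iff[OF N q])
  have Fv: "cdf N v = q"
    unfolding v_def VaR_def by (rule cdf_quantile[OF N q cont])
  have \<epsilon>: "\<forall>\<^sub>F \<epsilon> in at_right 0. 0 < \<epsilon> \<and> \<epsilon> < (1::real)"
    by (auto simp: eventually_at_right_field intro!: exI[of _ 1])
  {
    assume "v < l"
    \<comment> \<open>The strict gap survives scaling by 1 - \<epsilon> for small \<epsilon>. Every
      x \<ge> l then lies in the superlevel set even without the extra mass, so only the scaling
      matters.\<close>
    then have "q < cdf N l"
      using cdf_less_right[OF N der D] Fv by simp
    moreover have "((\<lambda>\<epsilon>. (1 - \<epsilon>) * cdf N l) \<longlongrightarrow> (1 - 0) * cdf N l) (at_right 0)"
      by (intro tendsto_intros)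
    ultimately have "\<forall>\<^sub>F \<epsilon> in at_right 0. q < (1 - \<epsilon>) * cdf N l"
      by (intro order_tendstoD(1)) auto
    with \<epsilon> have "\<forall>\<^sub>F \<epsilon> in at_right 0. \<forall>x. q \<le> contaminate \<epsilon> l (cdf N) x \<longleftrightarrow> q / (1 - \<epsilon>) \<le> cdf N x"
    proof eventually_elim
      case (elim \<epsilon>)
      have "q \<le> (1 - \<epsilon>) * cdf N x" if "l \<le> x" for x
        using elim mult_left_mono[OF cdf_nondecreasing[OF that], of "1 - \<epsilon>"] by linarith
      moreover from elim have "q / (1 - \<epsilon>) \<le> cdf N x \<longleftrightarrow> q \<le> (1 - \<epsilon>) * cdf N x" for x
        by (simp add: pos_divide_le_eq mult.commute)
      ultimately show ?case
        using elim by (auto simp: contaminate_eq add_increasing2)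
    qed
    then have "has_sensitivity (VaR q) (cdf N) l (inverse D * q)"
      by (intro has_sensitivity_quantile_shift[OF Q, where p = "\<lambda>\<epsilon>. q / (1 - \<epsilon>)"])
         (auto intro!: derivative_eq_intros)
    then show "has_sensitivity (VaR q) (cdf N) l (q / D)"
      by (simp add: field_simps)
  next
    assume "l = v"
    \<comment> \<open>With the atom exactly at v the superlevel set does not move: from v on, the
      added \<epsilon> outweighs the loss by scaling, and left of v there is only the loss.\<close>
    from \<epsilon> have "\<forall>\<^sub>F \<epsilon> in at_right 0. \<forall>x. q \<le> contaminate \<epsilon> l (cdf N) x \<longleftrightarrow> q \<le> cdf N x"
    proof eventually_elim
      case (elim \<epsilon>)
      show ?case
      proof
        fix x
        have "q \<le> (1 - \<epsilon>) * cdf N x + \<epsilon>" if "q \<le> cdf N x"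
        proof -
          have "q = (1 - \<epsilon>) * q + \<epsilon> * q"
            by (simp add: algebra_simps)
          also have "\<dots> \<le> (1 - \<epsilon>) * cdf N x + \<epsilon> * 1"
            using that elim q by (intro add_mono mult_left_mono) auto
          finally show ?thesis by simp
        qed
        moreover have "(1 - \<epsilon>) * cdf N x < q" if "cdf N x < q"
        proof -
          have "(1 - \<epsilon>) * cdf N x \<le> 1 * cdf N x"
            using elim by (intro mult_right_mono cdf_nonneg) auto
          with that show ?thesis by simp
        qed
        ultimately show "q \<le> contaminate \<epsilon> l (cdf N) x \<longleftrightarrow> q \<le> cdf N x"
          using le_iff[of x] \<open>l = v\<close> by (auto simp: contaminate_eq not_le)
      qed
    qed
    then have "has_sensitivity (VaR q) (cdf N) l (inverse D * 0)"
      by (intro has_sensitivity_quantile_shift[OF Q, where p = "\<lambda>_. q"]) auto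
    then show "has_sensitivity (VaR q) (cdf N) l 0"
      by simp
  next
    assume "l < v"
    \<comment> \<open>For small \<epsilon>, points x < l stay below q even if credited with the
      extra mass. So the mass may be counted at every x, which gives the level (q - \<epsilon>)/(1 -
      \<epsilon>).\<close>
    then have "cdf N l < q"
      using le_iff[of l] by auto
    moreover have "((\<lambda>\<epsilon>. (1 - \<epsilon>) * cdf N l + \<epsilon>) \<longlongrightarrow> (1 - 0) * cdf N l + 0) (at_right 0)"
      by (intro tendsto_intros)
    ultimately have "\<forall>\<^sub>F \<epsilon> in at_right 0. (1 - \<epsilon>) * cdf N l + \<epsilon> < q"
      by (intro order_tendstoD(2)) auto
    with \<epsilon> have "\<forall>\<^sub>F \<epsilon> in at_right 0. \<forall>x. q \<le> contaminate \<epsilon> l (cdf N) x \<longleftrightarrow>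
        (q - \<epsilon>) / (1 - \<epsilon>) \<le> cdf N x"
    proof eventually_elim
      case (elim \<epsilon>)
      have "(1 - \<epsilon>) * cdf N x + \<epsilon> < q" if "x < l" for x
        using elim mult_left_mono[OF cdf_nondecreasing[of x l], of "1 - \<epsilon>"] that by linarith
      moreover from elim have "(q - \<epsilon>) / (1 - \<epsilon>) \<le> cdf N x \<longleftrightarrow> q \<le> (1 - \<epsilon>) * cdf N x + \<epsilon>" for x
        by (simp add: pos_divide_le_eq mult.commute diff_le_eq)
      ultimately show ?case
        using elim by (auto simp: contaminate_eq not_le dest: less_le_trans)
    qed
    then have "has_sensitivity (VaR q) (cdf N) l (inverse D * (q - 1))"
      by (intro has_sensitivity_quantile_shift[OF Q, where p = "\<lambda>\<epsilon>. (q - \<epsilon>) / (1 - \<epsilon>)"])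
         (auto intro!: derivative_eq_intros)
    then show "has_sensitivity (VaR q) (cdf N) l ((q - 1) / D)"
      by (simp add: field_simps)
  }
qed

section \<open>Stop-loss expectations and the Rockafellar-Uryasev formula\<close>

lemma expectation_quantile:
  fixes g :: "real \<Rightarrow> real"
  assumes N: "real_distribution N" and g: "g \<in> borel_measurable borel"
  shows integrable_iff_quantile:
      "integrable N g \<longleftrightarrow> set_integrable lborel {0<..<1} (\<lambda>p. g (quantile (cdf N) p))"
    and integral_eq_quantile:
      "integral\<^sup>L N g = (LINT p:{0<..<1}|lborel. g (quantile (cdf N) p))"
proof -
  let ?\<Omega> = "restrict_space lborel {0<..<1::real}"
  have [measurable]: "quantile (cdf N) \<in> borel_measurable ?\<Omega>"
    using measurable_quantile[OF N] by (simp add: measurable_def space_restrict_space sets_restrict_space)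
  have "integrable N g \<longleftrightarrow> integrable ?\<Omega> (\<lambda>p. g (quantile (cdf N) p))"
    by (subst distr_quantile[OF N, symmetric]) (intro integrable_distr_eq g, measurable)
  then show "integrable N g \<longleftrightarrow> set_integrable lborel {0<..<1} (\<lambda>p. g (quantile (cdf N) p))"
    by (simp add: integrable_restrict_space set_integrable_def)
  have "integral\<^sup>L N g = (\<integral>p. g (quantile (cdf N) p) \<partial>?\<Omega>)"
    by (subst distr_quantile[OF N, symmetric]) (intro integral_distr g, measurable)
  then show "integral\<^sup>L N g = (LINT p:{0<..<1}|lborel. g (quantile (cdf N) p))"
    by (simp add: integral_restrict_space set_lebesgue_integral_def)
qed

text \<open>Measurability of \<open>quantile\<close> is known on (0,1) only, so the integrand is cut
  off to a subset of (0,1) before being treated on the whole line.\<close>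

lemma measurable_quantile_indicator:
  assumes N: "real_distribution N" and A: "A \<in> sets borel" "A \<subseteq> {0<..<1}"
    and g: "g \<in> borel_measurable borel"
  shows "(\<lambda>p. indicator A p * g (quantile (cdf N) p) :: real) \<in> borel_measurable lborel"
proof -
  have "(\<lambda>p. g (quantile (cdf N) p)) \<in> borel_measurable (restrict_space borel {0<..<1})"
    using measurable_quantile[OF N] g by (rule measurable_compose)
  then have "(\<lambda>p. indicator {0<..<1} p * g (quantile (cdf N) p) :: real) \<in> borel_measurable borel"
    by (simp add: borel_measurable_restrict_space_iff)
  then have "(\<lambda>p. indicator A p * (indicator {0<..<1} p * g (quantile (cdf N) p)) :: real)
      \<in> borel_measurable borel"
    using A by measurable
  also have "(\<lambda>p. indicator A p * (indicator {0<..<1} p * g (quantile (cdf N) p)) :: real) =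
      (\<lambda>p. indicator A p * g (quantile (cdf N) p))"
    using A(2) by (auto simp: fun_eq_iff indicator_def)
  finally show ?thesis by simp
qed

text \<open>Only the upper tail matters: on (0,q] the quantile is at most its value at q, so the
  positive part is bounded there, and \<open>ES_finite\<close> controls it on (q,1).\<close>

lemma integrable_stop_loss:
  assumes N: "real_distribution N" and q: "0 < q" "q < 1" and fin: "ES_finite q (cdf N)"
  shows "integrable N (\<lambda>x. max 0 (x - t))"
proof -
  let ?Q = "quantile (cdf N)"
  have "integrable lborel (\<lambda>p. indicator {0<..<1} p * max 0 (?Q p - t))"
  proof (rule Bochner_Integration.integrable_bound)
    show "integrable lborel (\<lambda>p. \<bar>indicator {q<..<1} p * ?Q p\<bar>
        + indicator {0<..<1} p * (\<bar>t\<bar> + \<bar>?Q q\<bar>))"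
      using fin unfolding ES_finite_def set_integrable_def
      by (intro Bochner_Integration.integrable_add integrable_abs integrable_mult_left) auto
    show "(\<lambda>p. indicator {0<..<1} p * max 0 (?Q p - t)) \<in> borel_measurable lborel"
      by (rule measurable_quantile_indicator[OF N]) auto
    have "?Q p \<le> ?Q q" if "0 < p" "p \<le> q" for p
      using quantile_mono[OF N that] q by simp
    then have "norm (indicator {0<..<1} p * max 0 (?Q p - t)) \<le>
        norm (\<bar>indicator {q<..<1} p * ?Q p\<bar> + indicator {0<..<1} p * (\<bar>t\<bar> + \<bar>?Q q\<bar>))" for p
      by (auto simp: indicator_def not_less) (smt (verit))
    then show "AE p in lborel. norm (indicator {0<..<1} p * max 0 (?Q p - t)) \<le>
        norm (\<bar>indicator {q<..<1} p * ?Q p\<bar> + indicator {0<..<1} p * (\<bar>t\<bar> + \<bar>?Q q\<bar>))"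
      by simp
  qed
  then show ?thesis
    by (subst integrable_iff_quantile[OF N]) (auto simp: set_integrable_def)
qed

text \<open>On (q,1) the quantile is at most t plus its positive excess over t, and on (0,q] the
  excess is nonnegative; integrating gives the inequality. For t = \<open>VaR\<close> the quantile
  is at least t on (q,1) and at most t on (0,q], so equality holds pointwise.\<close>

lemma ES_stop_loss:
  assumes N: "real_distribution N" and q: "0 < q" "q < 1"
    and int: "integrable N (\<lambda>x. max 0 (x - t))"
  shows ES_le_stop_loss: "(1 - q) * ES q (cdf N) \<le> (1 - q) * t + (\<integral>x. max 0 (x - t) \<partial>N)"
    and ES_eq_stop_loss: "t = VaR q (cdf N) \<Longrightarrow>
      (1 - q) * ES q (cdf N) = (1 - q) * t + (\<integral>x. max 0 (x - t) \<partial>N)"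
proof -
  let ?Q = "quantile (cdf N)"
  let ?u = "\<lambda>p. indicator {q<..<1} p * ?Q p"
  let ?w = "\<lambda>p. indicator {0<..<1} p * max 0 (?Q p - t)"
  have w: "integrable lborel ?w"
    using int by (subst (asm) integrable_iff_quantile[OF N]) (auto simp: set_integrable_def)
  have lower: "?Q q \<le> ?Q p" if "q < p" "p < 1" for p
    using quantile_mono[OF N] that q by simp
  have upper: "?Q p \<le> ?Q q" if "0 < p" "p \<le> q" for p
    using quantile_mono[OF N that] q by simp
  \<comment> \<open>Tail integrability is recovered from the stop-loss hypothesis, because the
    quantile is bounded below on (q,1). Hence finiteness of \<open>ES\<close> need not be assumed
    for the contaminated law.\<close>
  have u: "integrable lborel ?u"
  proof (rule Bochner_Integration.integrable_bound)
    show "integrable lborel (\<lambda>p. ?w p + indicator {0<..<1} p * (\<bar>t\<bar> + \<bar>?Q q\<bar>))"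
      using w by (intro Bochner_Integration.integrable_add integrable_mult_left) auto
    show "?u \<in> borel_measurable lborel"
      using q by (intro measurable_quantile_indicator[OF N, where g = "\<lambda>x. x"]) auto
    show "AE p in lborel. norm (?u p) \<le> norm (?w p + indicator {0<..<1} p * (\<bar>t\<bar> + \<bar>?Q q\<bar>))"
      using lower q by (intro AE_I2) (auto simp: indicator_def, smt (verit))
  qed
  have z: "integrable lborel (\<lambda>p. indicator {q<..<1} p * t)"
    using q by (intro integrable_mult_left) auto
  have ES: "(1 - q) * ES q (cdf N) = (\<integral>p. ?u p \<partial>lborel)"
    using q by (simp add: ES_def set_lebesgue_integral_def)
  have rhs: "(1 - q) * t + (\<integral>x. max 0 (x - t) \<partial>N) = (\<integral>p. indicator {q<..<1} p * t + ?w p \<partial>lborel)"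
    using q by (subst Bochner_Integration.integral_add[OF z w], subst integral_eq_quantile[OF N])
      (auto simp: set_lebesgue_integral_def)
  show "(1 - q) * ES q (cdf N) \<le> (1 - q) * t + (\<integral>x. max 0 (x - t) \<partial>N)"
    unfolding ES rhs using u z w q
    by (intro integral_mono Bochner_Integration.integrable_add) (auto simp: indicator_def)
  show "(1 - q) * ES q (cdf N) = (1 - q) * t + (\<integral>x. max 0 (x - t) \<partial>N)" if "t = VaR q (cdf N)"
    unfolding ES rhs
  proof (rule Bochner_Integration.integral_cong[OF refl])
    fix p :: real
    show "?u p = indicator {q<..<1} p * t + ?w p"
      using lower[of p] upper[of p] q that by (auto simp: VaR_def indicator_def)
  qed
qed

section \<open>The contaminated law as a measure, and the sensitivity of ES\<close>

text \<open>The stop-loss formula needs a measure behind the contaminated distribution function. It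
  is built as a Bernoulli(\<epsilon>) choice between the point mass at l and \<open>N\<close>;
  indicators of half-lines recover the distribution function.\<close>

lemma contaminated_distribution:
  assumes N: "real_distribution N" and \<epsilon>: "0 \<le> \<epsilon>" "\<epsilon> \<le> 1"
  obtains N' where "real_distribution N'" and "cdf N' = contaminate \<epsilon> l (cdf N)"
    and "\<And>g. g \<in> borel_measurable borel \<Longrightarrow> (\<And>x. 0 \<le> g x) \<Longrightarrow> integrable N g \<Longrightarrow>
      has_bochner_integral N' g ((1 - \<epsilon>) * (\<integral>x. g x \<partial>N) + \<epsilon> * g l)"
proof -
  interpret N: real_distribution N by fact
  let ?K = "\<lambda>b. if b then return borel l else N"
  let ?N = "measure_pmf (bernoulli_pmf \<epsilon>) \<bind> ?K"
  have K_sets: "prob_space (?K b) \<and> sets (?K b) = sets borel" for b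
    by (cases b) (auto intro: prob_space_return N.prob_space_axioms)
  have K: "?K \<in> measure_pmf (bernoulli_pmf \<epsilon>) \<rightarrow>\<^sub>M subprob_algebra borel"
    using K_sets by (simp add: space_subprob_algebra prob_space_imp_subprob_space)
  have nn: "(\<integral>\<^sup>+x. g x \<partial>?N) = g l * \<epsilon> + (\<integral>\<^sup>+x. g x \<partial>N) * (1 - \<epsilon>)"
    if "g \<in> borel_measurable borel" for g
    using \<epsilon> that by (subst nn_integral_bind[OF that K]) (simp add: nn_integral_return)
  have "prob_space ?N"
    using K_sets by (intro measure_pmf.prob_space_bind[OF _ K]) auto
  moreover have sets: "sets ?N = sets borel"
    using K_sets by (intro sets_bind) auto
  ultimately have N': "real_distribution ?N"
    unfolding real_distribution_def real_distribution_axioms_def by simp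
  then interpret N': real_distribution ?N .
  have hbi: "has_bochner_integral ?N g ((1 - \<epsilon>) * (\<integral>x. g x \<partial>N) + \<epsilon> * g l)"
    if g: "g \<in> borel_measurable borel" "\<And>x. 0 \<le> g x" "integrable N g" for g :: "real \<Rightarrow> real"
  proof (rule has_bochner_integral_nn_integral)
    have pos: "0 \<le> (\<integral>x. g x \<partial>N)"
      using g(2) by (intro Bochner_Integration.integral_nonneg)
    have "(\<integral>\<^sup>+x. ennreal (g x) \<partial>?N) = ennreal (g l) * \<epsilon> + ennreal (\<integral>x. g x \<partial>N) * (1 - \<epsilon>)"
      using g by (subst nn) (auto simp: nn_integral_eq_integral)
    also have "\<dots> = ennreal (g l * \<epsilon> + (\<integral>x. g x \<partial>N) * (1 - \<epsilon>))"
      using g(2) pos \<epsilon> by (simp add: ennreal_mult ennreal_plus)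
    finally show "(\<integral>\<^sup>+x. ennreal (g x) \<partial>?N) = ennreal ((1 - \<epsilon>) * (\<integral>x. g x \<partial>N) + \<epsilon> * g l)"
      by (simp add: mult.commute add.commute)
    show "0 \<le> (1 - \<epsilon>) * (\<integral>x. g x \<partial>N) + \<epsilon> * g l"
      using g(2) pos \<epsilon> by simp
  qed (use g in \<open>auto intro!: N'.measurable_finite_borel\<close>)
  have "cdf ?N x = contaminate \<epsilon> l (cdf N) x" for x
  proof -
    have "has_bochner_integral ?N (indicator {..x})
        ((1 - \<epsilon>) * (\<integral>y. indicator {..x} y \<partial>N) + \<epsilon> * indicator {..x} l)"
      by (rule hbi) (auto intro!: N.measurable_finite_borel simp: N.emeasure_eq_measure)
    then have "(\<integral>y. indicator {..x} y \<partial>?N) =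
        (1 - \<epsilon>) * (\<integral>y. indicator {..x} y \<partial>N) + \<epsilon> * (indicator {..x} l :: real)"
      by (rule has_bochner_integral_integral_eq)
    then show ?thesis
      by (simp add: cdf_def contaminate_def measure_return)
  qed
  with N' hbi show ?thesis
    by (intro that[of ?N]) auto
qed

lemma has_sensitivity_imp_tendsto:
  assumes "has_sensitivity \<rho> F l s"
  shows "((\<lambda>\<epsilon>. \<rho> (contaminate \<epsilon> l F)) \<longlongrightarrow> \<rho> F) (at_right 0)"
proof -
  have "((\<lambda>\<epsilon>. \<rho> F + \<epsilon> * ((\<rho> (contaminate \<epsilon> l F) - \<rho> F) / \<epsilon>)) \<longlongrightarrow> \<rho> F + 0 * s) (at_right 0)"
    using assms unfolding has_sensitivity_def by (intro tendsto_intros)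
  moreover have "\<forall>\<^sub>F \<epsilon> in at_right 0. \<rho> F + \<epsilon> * ((\<rho> (contaminate \<epsilon> l F) - \<rho> F) / \<epsilon>) =
      \<rho> (contaminate \<epsilon> l F)"
    using eventually_at_right_less[of 0] by eventually_elim simp
  ultimately show ?thesis
    by (simp add: tendsto_cong)
qed

text \<open>By the Rockafellar--Uryasev formula, \<open>(1 - q) * ES q\<close> is the minimum over \<open>t\<close> of
  \<open>(1 - q) * t + E (Y - t)\<^sup>+\<close>, attained at \<open>VaR q\<close>. The objective is affine in \<open>\<epsilon>\<close>, so comparing
  the minimizers of the original and of the contaminated problem squeezes the difference quotient;
  only continuity of the quantile in \<open>\<epsilon>\<close> is needed.\<close>

lemma has_sensitivity_ES:
  fixes N q l
  defines "v \<equiv> VaR q (cdf N)"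
  assumes N: "real_distribution N" and q: "0 < q" "q < 1" and fin: "ES_finite q (cdf N)"
    and lim: "((\<lambda>\<epsilon>. VaR q (contaminate \<epsilon> l (cdf N))) \<longlongrightarrow> v) (at_right 0)"
  shows "has_sensitivity (ES q) (cdf N) l (v + max 0 (l - v) / (1 - q) - ES q (cdf N))"
proof -
  define V where "V \<epsilon> = VaR q (contaminate \<epsilon> l (cdf N))" for \<epsilon>
  define E where "E \<epsilon> = ES q (contaminate \<epsilon> l (cdf N))" for \<epsilon>
  \<comment> \<open>\<open>A\<close> and \<open>B\<close> are the objectives of \<open>N\<close> and
    of the point mass at l.\<close>
  define A where "A t = (1 - q) * t + (\<integral>x. max 0 (x - t) \<partial>N)" for t
  define B where "B t = (1 - q) * t + max 0 (l - t)" for t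
  define e where "e = ES q (cdf N)"
  note int = integrable_stop_loss[OF N q fin]
  have A_ge: "(1 - q) * e \<le> A t" for t
    unfolding A_def e_def by (rule ES_le_stop_loss[OF N q int])
  have A_v: "(1 - q) * e = A v"
    unfolding A_def e_def by (rule ES_eq_stop_loss[OF N q int]) (simp add: v_def)
  have bounds: "B (V \<epsilon>) / (1 - q) - e \<le> (E \<epsilon> - e) / \<epsilon> \<and> (E \<epsilon> - e) / \<epsilon> \<le> B v / (1 - q) - e"
    if \<epsilon>: "0 < \<epsilon>" "\<epsilon> < 1" for \<epsilon>
  proof -
    obtain N' where N': "real_distribution N'" "cdf N' = contaminate \<epsilon> l (cdf N)"
      and hbi: "\<And>g. g \<in> borel_measurable borel \<Longrightarrow> (\<And>x. 0 \<le> g x) \<Longrightarrow> integrable N g \<Longrightarrow>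
        has_bochner_integral N' g ((1 - \<epsilon>) * (\<integral>x. g x \<partial>N) + \<epsilon> * g l)"
      using contaminated_distribution[OF N, of \<epsilon> l] \<epsilon> by auto
    have mix: "has_bochner_integral N' (\<lambda>x. max 0 (x - t))
        ((1 - \<epsilon>) * (\<integral>x. max 0 (x - t) \<partial>N) + \<epsilon> * max 0 (l - t))" for t
      using int by (intro hbi) auto
    have int': "integrable N' (\<lambda>x. max 0 (x - t))" for t
      using mix by (rule integrable.intros)
    have obj: "(1 - q) * t + (\<integral>x. max 0 (x - t) \<partial>N') = (1 - \<epsilon>) * A t + \<epsilon> * B t" for t
      unfolding A_def B_def has_bochner_integral_integral_eq[OF mix] by (simp add: algebra_simps)
    \<comment> \<open>Upper bound: the old minimizer v is a trial point for the contaminated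
      problem.\<close>
    have "(1 - q) * E \<epsilon> \<le> (1 - \<epsilon>) * A v + \<epsilon> * B v"
      using ES_le_stop_loss[OF N'(1) q int', of v] by (simp add: obj N'(2) E_def)
    then have "(1 - q) * (E \<epsilon> - e) \<le> \<epsilon> * (B v - (1 - q) * e)"
      unfolding A_v[symmetric] by (simp add: algebra_simps)
    \<comment> \<open>Lower bound: the new minimizer \<open>V \<epsilon>\<close> is a trial point
      for the original problem.\<close>
    moreover have "(1 - \<epsilon>) * ((1 - q) * e) + \<epsilon> * B (V \<epsilon>) \<le> (1 - q) * E \<epsilon>"
    proof -
      have "(1 - \<epsilon>) * ((1 - q) * e) \<le> (1 - \<epsilon>) * A (V \<epsilon>)"
        using \<epsilon> by (intro mult_left_mono A_ge) auto
      moreover have "(1 - q) * E \<epsilon> = (1 - \<epsilon>) * A (V \<epsilon>) + \<epsilon> * B (V \<epsilon>)"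
        using ES_eq_stop_loss[OF N'(1) q int', of "V \<epsilon>"] by (simp add: obj N'(2) E_def V_def)
      ultimately show ?thesis by simp
    qed
    then have "\<epsilon> * (B (V \<epsilon>) - (1 - q) * e) \<le> (1 - q) * (E \<epsilon> - e)"
      by (simp add: algebra_simps)
    ultimately show ?thesis
      using \<epsilon> q by (simp add: field_simps)
  qed
  have ev: "\<forall>\<^sub>F \<epsilon> in at_right 0. 0 < \<epsilon> \<and> \<epsilon> < (1::real)"
    by (auto simp: eventually_at_right_field intro!: exI[of _ 1])
  have "((\<lambda>\<epsilon>. (E \<epsilon> - e) / \<epsilon>) \<longlongrightarrow> B v / (1 - q) - e) (at_right 0)"
  proof (rule tendsto_sandwich)
    show "\<forall>\<^sub>F \<epsilon> in at_right 0. B (V \<epsilon>) / (1 - q) - e \<le> (E \<epsilon> - e) / \<epsilon>"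
      using ev by eventually_elim (use bounds in blast)
    show "\<forall>\<^sub>F \<epsilon> in at_right 0. (E \<epsilon> - e) / \<epsilon> \<le> B v / (1 - q) - e"
      using ev by eventually_elim (use bounds in blast)
    show "((\<lambda>\<epsilon>. B (V \<epsilon>) / (1 - q) - e) \<longlongrightarrow> B v / (1 - q) - e) (at_right 0)"
      unfolding B_def using lim q by (intro tendsto_intros) (auto simp: V_def)
  qed simp
  moreover have "B v / (1 - q) = v + max 0 (l - v) / (1 - q)"
    using q by (simp add: B_def add_divide_distrib)
  ultimately show ?thesis
    unfolding has_sensitivity_def E_def e_def by simp
qed

section \<open>Specialization to the law of Y at the level \<omega>\<close>

theorem proposition2p5p1:
  fixes M :: "'a measure" and X Y :: "'a \<Rightarrow> real"
    and C :: "real \<Rightarrow> real \<Rightarrow> real" and f\<^sub>Y F\<^sub>Y :: "real \<Rightarrow> real"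
    and \<alpha> \<beta> \<omega> v :: real
  assumes "prob_space M"
    and "X \<in> borel_measurable M" and "Y \<in> borel_measurable M"
    and "has_copula M X Y C" and "positively_dependent C"
    and "F\<^sub>Y = distribution_fun M Y"
    and "\<And>y. 0 \<le> f\<^sub>Y y" and "distributed M lborel Y (\<lambda>y. ennreal (f\<^sub>Y y))"
    and "0 < \<alpha>" "\<alpha> < 1" "0 < \<beta>" "\<beta> < 1"
    and "\<omega> = omega_level \<alpha> \<beta> C" and "v = VaR \<omega> F\<^sub>Y"
    and "(F\<^sub>Y has_real_derivative f\<^sub>Y v) (at v)" and "0 < f\<^sub>Y v"
  shows "(\<forall>l.
            (v < l \<longrightarrow> has_sensitivity (CoVaR \<alpha> \<beta> C) F\<^sub>Y l (\<omega> / f\<^sub>Y v)) \<and>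
            (l = v \<longrightarrow> has_sensitivity (CoVaR \<alpha> \<beta> C) F\<^sub>Y l 0) \<and>
            (l < v \<longrightarrow> has_sensitivity (CoVaR \<alpha> \<beta> C) F\<^sub>Y l ((\<omega> - 1) / f\<^sub>Y v))) \<and>
         (ES_finite \<omega> F\<^sub>Y \<longrightarrow> (\<forall>l.
            (v \<le> l \<longrightarrow> has_sensitivity (CoES \<alpha> \<beta> C) F\<^sub>Y l
               (l / (1 - \<omega>) - \<omega> / (1 - \<omega>) * v - ES \<omega> F\<^sub>Y)) \<and>
            (l \<le> v \<longrightarrow> has_sensitivity (CoES \<alpha> \<beta> C) F\<^sub>Y l (v - ES \<omega> F\<^sub>Y))))"
proof -
  interpret M: prob_space M by fact
  define N where "N = distr M borel Y"
  have N: "real_distribution N"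
    unfolding N_def using assms(3) by (rule M.real_distribution_distr)
  interpret N: real_distribution N by fact
  have F: "F\<^sub>Y = cdf N"
    using assms(6) by (simp add: N_def)
  have q: "0 < \<omega>" "\<omega> < 1"
    using omega_level_bounds[of C \<alpha> \<beta>] assms(4,9-13) by (auto simp: has_copula_def)
  \<comment> \<open>A law with a density has no atoms, so its distribution function is continuous
    everywhere and not just at v, as \<open>DERIV_quantile\<close> requires.\<close>
  have "N = density lborel (\<lambda>y. ennreal (f\<^sub>Y y))"
    using distributed_distr_eq_density[OF assms(8)] distr_cong[of M M borel lborel Y Y]
    by (simp add: N_def)
  moreover have "AE y in lborel. y \<in> {x} \<longrightarrow> ennreal (f\<^sub>Y y) \<le> 0" for x
    using AE_lborel_singleton[of x] by eventually_elim simp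
  ultimately have "{x} \<in> null_sets N" for x
    using distributed_borel_measurable[OF assms(8)] by (simp add: null_sets_density_iff)
  then have cont: "isCont (cdf N) x" for x
    by (simp add: N.isCont_cdf null_sets_def measure_def)
  note VaR = has_sensitivity_VaR[OF N cont q, of "f\<^sub>Y v", folded F, folded assms(14), OF assms(15,16)]
  have rho: "CoVaR \<alpha> \<beta> C = VaR \<omega>" "CoES \<alpha> \<beta> C = ES \<omega>"
    using assms(13) by (auto simp: CoVaR_def CoES_def fun_eq_iff)
  have lim: "((\<lambda>\<epsilon>. VaR \<omega> (contaminate \<epsilon> l F\<^sub>Y)) \<longlongrightarrow> v) (at_right 0)" for l
    using VaR[of l] has_sensitivity_imp_tendsto[of "VaR \<omega>" F\<^sub>Y l] assms(14)
    by (metis linorder_cases)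
  have ES: "has_sensitivity (ES \<omega>) F\<^sub>Y l (v + max 0 (l - v) / (1 - \<omega>) - ES \<omega> F\<^sub>Y)"
    if "ES_finite \<omega> F\<^sub>Y" for l
    using has_sensitivity_ES[OF N q, of l] that lim[of l] by (simp add: F assms(14))
  \<comment> \<open>The single formula with \<open>max\<close> splits into the two stated branches,
    which agree at l = v.\<close>
  have "v + max 0 (l - v) / (1 - \<omega>) = l / (1 - \<omega>) - \<omega> / (1 - \<omega>) * v" if "v \<le> l" for l
  proof -
    have "v + max 0 (l - v) / (1 - \<omega>) = ((1 - \<omega>) * v + (l - v)) / (1 - \<omega>)"
      using that q by (simp add: add_divide_distrib)
    also have "\<dots> = (l - \<omega> * v) / (1 - \<omega>)"
      by (simp add: algebra_simps)
    finally show ?thesis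
      by (simp add: diff_divide_distrib)
  qed
  moreover have "v + max 0 (l - v) / (1 - \<omega>) = v" if "l \<le> v" for l
    using that by simp
  ultimately show ?thesis
    unfolding rho using VaR ES by metis
qed

end
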